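(* Let $v\colon\mathbb{R}^n\to\mathbb{R}^m$ be a $1$-Lipschitz map (with respect to Euclidean norms). If $\mathcal{S}_1,\mathcal{S}_2$ are two leaves of $v$ and $\mathcal{S}_1\cap\mathcal{S}_2\neq\emptyset$, then the intersection $\mathcal{S}_1\cap\mathcal{S}_2$ is a common face of $\mathcal{S}_1$ and of $\mathcal{S}_2$.
   Context: A leaf of a $1$-Lipschitz map $v\colon\mathbb{R}^n\to\mathbb{R}^m$ is a set $\mathcal{S}\subset\mathbb{R}^n$, maximal with respect to inclusion, such that $\|v(x)-v(y)\|=\|x-y\|$ for all $x,y\in\mathcal{S}$. It is known that leaves are closed and convex. A face of a convex set $\mathcal{F}$ is a (convex) subset $\mathcal{G}\subset\mathcal{F}$ such that if for some $t\in(0,1)$ and some $x,y\in\mathcal{F}$ we have $tx+(1-t)y\in\mathcal{G}$, then $x,y\in\mathcal{G}$. *)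

theory Defs
  imports "HOL-Analysis.Analysis"
begin

definition isometric_on :: "('a::real_normed_vector \<Rightarrow> 'b::real_normed_vector) \<Rightarrow> 'a set \<Rightarrow> bool" where
  "isometric_on v S \<longleftrightarrow> (\<forall>x\<in>S. \<forall>y\<in>S. norm (v x - v y) = norm (x - y))"

definition leaf :: "('a::real_normed_vector \<Rightarrow> 'b::real_normed_vector) \<Rightarrow> 'a set \<Rightarrow> bool" where
  "leaf v S \<longleftrightarrow> isometric_on v S \<and> (\<forall>T. isometric_on v T \<and> S \<subseteq> T \<longrightarrow> T = S)"

end

theory Submission
  imports Defs
begin

text \<open>
  Everything rests on Stewart's identity, which expresses the squared distance from a point \<open>z\<close>
  to \<open>(1 - t) a + t b\<close> through the squared distances between \<open>a\<close>, \<open>b\<close> and \<open>z\<close>. It first shows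
  that a \<open>1\<close>-Lipschitz map preserving the distance between \<open>a\<close> and \<open>b\<close> is affine on the segment
  from \<open>a\<close> to \<open>b\<close> (lemma \<open>lipschitz_affine_on_segment\<close>). Write
  \<open>d y s = |y - s|^2 - |v y - v s|^2\<close> for the defect of isometry, which is nonnegative. For such
  \<open>a\<close>, \<open>b\<close>, any point \<open>s\<close> and \<open>x = (1 - t) a + t b\<close> with \<open>0 \<le> t \<le> 1\<close>, the identity applied in
  the domain and in the codomain gives \<open>d x s = (1 - t) d a s + t d b s\<close>
  (lemma \<open>lipschitz_defect_segment\<close>).

  Let \<open>a\<close> and \<open>b\<close> lie in one leaf. The defects at \<open>a\<close> and \<open>b\<close> vanish for all \<open>s\<close> in that leaf, hence so does the one at \<open>x\<close>, and
  maximality yields convexity of the leaf. Conversely, for \<open>0 < t < 1\<close>, if the defect at \<open>x\<close>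
  vanishes for all \<open>s\<close> in another leaf, so do those at \<open>a\<close> and \<open>b\<close>, and maximality puts \<open>a\<close> and
  \<open>b\<close> in that other leaf. This is the face property.
\<close>

lemma stewart_identity:
  fixes a b z :: "'a::real_inner"
  shows "(norm ((1 - t) *\<^sub>R a + t *\<^sub>R b - z))\<^sup>2 =
    (1 - t) * (norm (a - z))\<^sup>2 + t * (norm (b - z))\<^sup>2 - t * (1 - t) * (norm (a - b))\<^sup>2"
  unfolding power2_norm_eq_inner
  by (simp add: inner_diff_left inner_diff_right inner_add_left inner_add_right
      inner_commute algebra_simps)

lemma lipschitz_1_norm_le:
  assumes "1-lipschitz_on UNIV v"
  shows "norm (v x - v y) \<le> norm (x - y)"
  using lipschitz_onD[OF assms, of x y] by (simp add: dist_norm)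

lemma lipschitz_affine_on_segment:
  fixes v :: "'a::real_inner \<Rightarrow> 'b::real_inner"
  assumes lip: "1-lipschitz_on UNIV v"
    and iso: "norm (v a - v b) = norm (a - b)"
    and t: "0 \<le> t" "t \<le> 1"
  shows "v ((1 - t) *\<^sub>R a + t *\<^sub>R b) = (1 - t) *\<^sub>R v a + t *\<^sub>R v b"
proof -
  define x where "x = (1 - t) *\<^sub>R a + t *\<^sub>R b"
  let ?D = "norm (a - b)"
  have "a - x = t *\<^sub>R (a - b)" "b - x = (1 - t) *\<^sub>R (b - a)"
    by (simp_all add: x_def algebra_simps)
  then have "norm (a - x) = t * ?D" "norm (b - x) = (1 - t) * ?D"
    using t by (simp_all add: norm_minus_commute)
  then have "norm (v a - v x) \<le> t * ?D" "norm (v b - v x) \<le> (1 - t) * ?D"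
    using lipschitz_1_norm_le[OF lip, of a x] lipschitz_1_norm_le[OF lip, of b x] by simp_all
  then have le: "(norm (v a - v x))\<^sup>2 \<le> (t * ?D)\<^sup>2" "(norm (v b - v x))\<^sup>2 \<le> ((1 - t) * ?D)\<^sup>2"
    by (simp_all add: power_mono)
  \<comment> \<open>Stewart's identity with \<open>z = v x\<close>: the bounds above force the distance to be zero.\<close>
  have "(norm ((1 - t) *\<^sub>R v a + t *\<^sub>R v b - v x))\<^sup>2 =
      (1 - t) * (norm (v a - v x))\<^sup>2 + t * (norm (v b - v x))\<^sup>2 - t * (1 - t) * ?D\<^sup>2"
    by (simp add: stewart_identity iso)
  also have "\<dots> \<le> (1 - t) * (t * ?D)\<^sup>2 + t * ((1 - t) * ?D)\<^sup>2 - t * (1 - t) * ?D\<^sup>2"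
    using mult_left_mono[OF le(1), of "1 - t"] mult_left_mono[OF le(2), of t] t by linarith
  also have "\<dots> = 0"
    by (simp add: power2_eq_square algebra_simps)
  finally show ?thesis
    by (simp add: x_def)
qed

lemma lipschitz_defect_segment:
  fixes v :: "'a::real_inner \<Rightarrow> 'b::real_inner"
  assumes lip: "1-lipschitz_on UNIV v"
    and iso: "norm (v a - v b) = norm (a - b)"
    and t: "0 \<le> t" "t \<le> 1"
    and x: "x = (1 - t) *\<^sub>R a + t *\<^sub>R b"
  shows "(norm (x - s))\<^sup>2 - (norm (v x - v s))\<^sup>2 =
    (1 - t) * ((norm (a - s))\<^sup>2 - (norm (v a - v s))\<^sup>2) +
    t * ((norm (b - s))\<^sup>2 - (norm (v b - v s))\<^sup>2)"
  unfolding x lipschitz_affine_on_segment[OF lip iso t] stewart_identity iso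
  by (simp add: algebra_simps)

lemma leaf_isometric:
  assumes "leaf v S" "x \<in> S" "y \<in> S"
  shows "norm (v x - v y) = norm (x - y)"
  using assms by (simp add: leaf_def isometric_on_def)

lemma leaf_memI:
  assumes "leaf v S" and "\<And>s. s \<in> S \<Longrightarrow> norm (v x - v s) = norm (x - s)"
  shows "x \<in> S"
proof -
  have "isometric_on v (insert x S)"
    using assms by (auto simp: leaf_def isometric_on_def norm_minus_commute)
  then show ?thesis
    using assms(1) unfolding leaf_def by blast
qed

lemma leaf_convex:
  fixes v :: "'a::real_inner \<Rightarrow> 'b::real_inner"
  assumes lip: "1-lipschitz_on UNIV v" and S: "leaf v S"
  shows "convex S"
  unfolding convex_alt
proof (intro ballI allI impI)
  fix a b and t :: real
  assume ab: "a \<in> S" "b \<in> S" and t: "0 \<le> t \<and> t \<le> 1"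
  show "(1 - t) *\<^sub>R a + t *\<^sub>R b \<in> S" (is "?x \<in> S")
  proof (rule leaf_memI[OF S])
    fix s assume s: "s \<in> S"
    have "(norm (?x - s))\<^sup>2 - (norm (v ?x - v s))\<^sup>2 = 0"
      using lipschitz_defect_segment[OF lip leaf_isometric[OF S ab], of t ?x s] t
        leaf_isometric[OF S ab(1) s] leaf_isometric[OF S ab(2) s] by simp
    then show "norm (v ?x - v s) = norm (?x - s)"
      by simp
  qed
qed

lemma leaf_Int_face_of:
  fixes v :: "'a::real_inner \<Rightarrow> 'b::real_inner"
  assumes lip: "1-lipschitz_on UNIV v" and S: "leaf v S" and T: "leaf v T"
  shows "(S \<inter> T) face_of S"
  unfolding face_of_def
proof (intro conjI ballI impI)
  show "convex (S \<inter> T)"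
    by (intro convex_Int leaf_convex[OF lip] S T)
next
  fix a b x
  assume ab: "a \<in> S" "b \<in> S" and xST: "x \<in> S \<inter> T" and "x \<in> open_segment a b"
  then obtain t where t: "0 < t" "t < 1" and x: "x = (1 - t) *\<^sub>R a + t *\<^sub>R b"
    by (auto simp: in_segment)
  let ?d = "\<lambda>y s. (norm (y - s))\<^sup>2 - (norm (v y - v s))\<^sup>2"
  have nonneg: "0 \<le> ?d y s" for y s
    using lipschitz_1_norm_le[OF lip, of y s] by (simp add: power_mono)
  have "?d a s = 0 \<and> ?d b s = 0" if s: "s \<in> T" for s
  proof -
    have "?d x s = 0"
      using leaf_isometric[OF T _ s, of x] xST by simp
    then have "(1 - t) * ?d a s + t * ?d b s = 0"
      using lipschitz_defect_segment[OF lip leaf_isometric[OF S ab] _ _ x, of s] t by simp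
    moreover have "0 \<le> (1 - t) * ?d a s" "0 \<le> t * ?d b s"
      using nonneg t by simp_all
    ultimately have "(1 - t) * ?d a s = 0" "t * ?d b s = 0"
      by linarith+
    then show ?thesis
      using t by simp
  qed
  then have "norm (v a - v s) = norm (a - s)" "norm (v b - v s) = norm (b - s)" if "s \<in> T" for s
    using that by simp_all
  then have "a \<in> T" "b \<in> T"
    by (auto intro: leaf_memI[OF T])
  then show "a \<in> S \<inter> T" "b \<in> S \<inter> T"
    using ab by simp_all
qed simp

theorem lemma2p2:
  fixes v :: "real ^ 'n \<Rightarrow> real ^ 'm"
    and S1 S2 :: "(real ^ 'n) set"
  assumes "1-lipschitz_on UNIV v"
    and "leaf v S1"
    and "leaf v S2"
    and "S1 \<inter> S2 \<noteq> {}"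
  shows "(S1 \<inter> S2) face_of S1 \<and> (S1 \<inter> S2) face_of S2"
  using leaf_Int_face_of[OF assms(1,2,3)] leaf_Int_face_of[OF assms(1,3,2)]
  by (simp add: Int_commute)

end
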